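(* Let $f,g:\{0,1\}^n\to\{1,-1\}$ be two functions given by oracle access. If one takes $C_n=H^{\otimes n}$ in the algorithm $\mathbb{A}(C_n)$, started from the state $|0\rangle^{\otimes n}\otimes|0\rangle^{\otimes n+1}$, then upon measuring the predetermined $2n$ qubits $r_1,\dots,r_n,q_1,\dots,q_n$ at the end of $\mathbb{A}(C_n)$ in the computational basis, the probability of getting the output $\mathbf{u}||0^n$ is $\frac{C_{f,g}(\mathbf{u})^2}{2^{3n}}$ for all $\mathbf{u}\in\{0,1\}^n$.
   Context: The cross-correlation of $f,g:\{0,1\}^n\to\{1,-1\}$ at $\mathbf{u}\in\{0,1\}^n$ is $C_{f,g}(\mathbf{u})=\sum_{\mathbf{x}\in\{0,1\}^n}f(\mathbf{x})g(\mathbf{x}\oplus\mathbf{u})$. The oracle of $h:\{0,1\}^n\to\{1,-1\}$ is the unitary $U_h|\mathbf{x}\rangle|a\rangle=|\mathbf{x}\rangle\left|a\oplus\frac{1-h(\mathbf{x})}{2}\right\rangle$ on $n+1$ qubits. $H$ is the $2\times2$ (normalized) Hadamard gate, $X$ is the NOT gate, and $||$ denotes concatenation of bit strings. The algorithm $\mathbb{A}(C_n)$, for a unitary $C_n$ on $n$ qubits, acts on an $n$-qubit register $R$ with qubits $r_1,\dots,r_n$ and an $(n+1)$-qubit register $Q$ with qubits $q_1,\dots,q_{n+1}$, by applying in this order: (1) $C_n$ on $R$; (2) $HX$ on $q_{n+1}$ (so $|0\rangle\mapsto|-\rangle$); (3) $H^{\otimes n}$ on $q_1,\dots,q_n$;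 (4) the oracle $U_f$ on $Q$; (5) $H^{\otimes n}$ on $q_1,\dots,q_n$; (6) the operator $DC$, which is the product over $1\le i\le n$ of the doubly-controlled NOT gates with control qubits $r_i,q_i$ and target qubit $q_{n+1}$; (7) $H^{\otimes n}$ on $q_1,\dots,q_n$; (8) the oracle $U_g$ on $Q$; (9) $H^{\otimes n}$ on $q_1,\dots,q_n$. *)

theory Defs
  imports "HOL-Analysis.Analysis" "HOL-Library.Z2"
begin

instance bit :: finite
proof
  have "(UNIV :: bit set) \<subseteq> {0, 1}"
    using bit_not_zero_iff by blast
  then show "finite (UNIV :: bit set)"
    by (rule finite_subset) simp
qed

text \<open>
  Bit strings of length \<open>n = CARD('n)\<close> are vectors over the two-element field, so that \<open>+\<close> on
  strings is bitwise exclusive-or. The state space of a quantum register whose computational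
  basis is labelled by the finite type \<open>'b\<close> is \<open>complex ^ 'b\<close>, and operators are matrices
  over it. The register \<open>R\<close> has labels \<open>bit ^ 'n\<close>, and \<open>Q\<close> has labels
  \<open>(bit ^ 'n) \<times> bit\<close>, the last component being the qubit with index \<open>n + 1\<close>.
\<close>

type_synonym 'n bits = "bit ^ 'n"
type_synonym 'b operator = "complex ^ 'b ^ 'b"
type_synonym 'n regQ = "'n bits \<times> bit"
type_synonym 'n regRQ = "'n bits \<times> 'n regQ"

definition cross_correlation :: "('n::finite bits \<Rightarrow> int) \<Rightarrow> ('n bits \<Rightarrow> int) \<Rightarrow> 'n bits \<Rightarrow> int"
  where "cross_correlation f g u = (\<Sum>x\<in>UNIV. f x * g (x + u))"

definition ket :: "'b::finite \<Rightarrow> complex ^ 'b"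
  where "ket x = axis x 1"

definition basis_map :: "('b::finite \<Rightarrow> 'b) \<Rightarrow> 'b operator"
  where "basis_map \<phi> = (\<chi> y x. if y = \<phi> x then 1 else 0)"

lemma basis_map_ket: "basis_map \<phi> *v ket x = ket (\<phi> x)"
proof -
  have "(\<Sum>k\<in>UNIV. (if y = \<phi> k then 1 else 0) * (if k = x then 1 else 0)) =
      (if y = \<phi> x then 1 else (0 :: complex))" for y
    using sum.delta[of UNIV x "\<lambda>k. if y = \<phi> k then 1 else (0 :: complex)"]
    by (simp add: mult_delta_right)
  then show ?thesis
    by (simp add: basis_map_def ket_def axis_def matrix_vector_mult_def vec_eq_iff)
qed

lemma basis_map_mult: "basis_map \<phi> ** basis_map \<psi> = basis_map (\<phi> \<circ> \<psi>)"
proof -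
  have "(\<Sum>k\<in>UNIV. (if y = \<phi> k then 1 else 0) * (if k = \<psi> x then 1 else 0)) =
      (if y = \<phi> (\<psi> x) then 1 else (0 :: complex))" for x y
    using sum.delta[of UNIV "\<psi> x" "\<lambda>k. if y = \<phi> k then 1 else (0 :: complex)"]
    by (simp add: mult_delta_right)
  then show ?thesis
    unfolding basis_map_def matrix_matrix_mult_def vec_eq_iff by simp
qed

definition tensor :: "'b::finite operator \<Rightarrow> 'c::finite operator \<Rightarrow> ('b \<times> 'c) operator"
    (infixr \<open>\<otimes>\<^sub>o\<close> 72)
  where "A \<otimes>\<^sub>o B = (\<chi> y x. A $ fst y $ fst x * B $ snd y $ snd x)"

definition tensor_power :: "bit operator \<Rightarrow> 'n::finite bits operator"
  where "tensor_power A = (\<chi> y x. \<Prod>i\<in>UNIV. A $ (y $ i) $ (x $ i))"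

definition hadamard :: "bit operator"
  where "hadamard = (\<chi> y x. (if y = 1 \<and> x = 1 then - 1 else 1) / of_real (sqrt 2))"

definition not_gate :: "bit operator"
  where "not_gate = basis_map (\<lambda>a. a + 1)"

text \<open>Only meaningful for \<open>h\<close> with values in \<open>{1, - 1}\<close>, where \<open>(1 - h x) div 2\<close> is exact.\<close>

definition oracle_op :: "('n::finite bits \<Rightarrow> int) \<Rightarrow> 'n regQ operator"
  where "oracle_op h = basis_map (\<lambda>(x, a). (x, a + of_int ((1 - h x) div 2)))"

text \<open>The NOT on the last qubit of \<open>Q\<close>, controlled by the \<open>i\<close>-th qubits of \<open>R\<close> and \<open>Q\<close>.\<close>

definition toffoli :: "'n::finite \<Rightarrow> 'n regRQ operator"
  where "toffoli i = basis_map (\<lambda>(r, q, a). (r, q, if r $ i = 1 \<and> q $ i = 1 then a + 1 else a))"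

lemma toffoli_commute: "toffoli i ** toffoli j = toffoli j ** toffoli i"
proof -
  have "(\<lambda>(r, q, a). (r, q, if r $ i = 1 \<and> q $ i = 1 then a + 1 else a)) \<circ>
      (\<lambda>(r, q, a). (r, q, if r $ j = 1 \<and> q $ j = 1 then a + 1 else a)) =
      (\<lambda>(r, q, a). (r, q, if r $ j = 1 \<and> q $ j = 1 then a + 1 else a)) \<circ>
      (\<lambda>(r, q, a :: bit). (r :: 'a bits, q :: 'a bits, if r $ i = 1 \<and> q $ i = 1 then a + 1 else a))"
    by auto
  then show ?thesis
    by (simp add: toffoli_def basis_map_mult)
qed

lemma comp_fun_commute_toffoli: "comp_fun_commute (\<lambda>i A. toffoli i ** A)"
proof
  fix i j :: 'a
  show "(\<lambda>A. toffoli j ** A) \<circ> (\<lambda>A. toffoli i ** A) = (\<lambda>A. toffoli i ** A) \<circ> (\<lambda>A. toffoli j ** A)"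
    by (simp add: fun_eq_iff matrix_mul_assoc toffoli_commute)
qed

text \<open>
  By the preceding lemma the product of all the Toffoli gates does not depend on the order
  of the factors, so that the fold is well defined.
\<close>

definition DC :: "'n::finite regRQ operator"
  where "DC = Finite_Set.fold (\<lambda>i A. toffoli i ** A) (mat 1) UNIV"

definition on_R :: "'n::finite bits operator \<Rightarrow> 'n regRQ operator"
  where "on_R A = A \<otimes>\<^sub>o mat 1"

definition on_Q :: "'n::finite regQ operator \<Rightarrow> 'n regRQ operator"
  where "on_Q A = mat 1 \<otimes>\<^sub>o A"

definition on_Q_init :: "'n::finite bits operator \<Rightarrow> 'n regRQ operator"
  where "on_Q_init A = on_Q (A \<otimes>\<^sub>o mat 1)"

definition on_Q_last :: "bit operator \<Rightarrow> 'n::finite regRQ operator"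
  where "on_Q_last A = on_Q (mat 1 \<otimes>\<^sub>o A)"

text \<open>The rightmost factor is the gate that is applied first.\<close>

definition algorithm ::
    "('n::finite bits \<Rightarrow> int) \<Rightarrow> ('n bits \<Rightarrow> int) \<Rightarrow> 'n bits operator \<Rightarrow> 'n regRQ operator"
  where "algorithm f g C =
    on_Q_init (tensor_power hadamard) **
    on_Q (oracle_op g) **
    on_Q_init (tensor_power hadamard) **
    DC **
    on_Q_init (tensor_power hadamard) **
    on_Q (oracle_op f) **
    on_Q_init (tensor_power hadamard) **
    on_Q_last (hadamard ** not_gate) **
    on_R C"

definition concat_bits :: "'n::finite bits \<Rightarrow> 'm::finite bits \<Rightarrow> ('n + 'm) bits"
  where "concat_bits u v = (\<chi> k. case k of Inl i \<Rightarrow> u $ i | Inr j \<Rightarrow> v $ j)"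

definition measured_qubits :: "'n::finite regRQ \<Rightarrow> ('n + 'n) bits"
  where "measured_qubits = (\<lambda>(r, q, a). concat_bits r q)"

text \<open>
  Born rule for measuring all qubits but the last one of \<open>Q\<close> in the computational basis.
\<close>

definition outcome_prob :: "complex ^ ('n::finite regRQ) \<Rightarrow> ('n + 'n) bits \<Rightarrow> real"
  where "outcome_prob \<psi> w = (\<Sum>z | measured_qubits z = w. (cmod (\<psi> $ z))\<^sup>2)"

end

theory Submission
  imports Defs
begin

text \<open>
  Once the last qubit of \<open>Q\<close> is \<open>|-\<rangle>\<close> it stays so, and the oracles and \<open>DC\<close> act by phase
  kickback: \<open>U\<^sub>f\<close> multiplies the amplitude at \<open>(r, q)\<close> by \<open>f q\<close>, and \<open>DC\<close> multiplies it by the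
  character \<open>(-1)\<close> to the power \<open>r \<cdot> q\<close>. Conjugating the latter by Hadamard transforms of \<open>q\<close>
  translates \<open>q\<close> by \<open>r\<close>. Before the last Hadamard transform the amplitude at \<open>(r, q)\<close> is
  therefore proportional to \<open>f (q + r) * g q\<close>, and the transform evaluated at \<open>0\<close> sums this
  over \<open>q\<close>.
\<close>

lemma UNIV_bit: "(UNIV :: bit set) = {0, 1}"
  using bit_not_zero_iff by blast

lemma bits_add_self: "x + x = (0 :: 'n::finite bits)"
  by (simp add: vec_eq_iff)

lemma bits_add_left_cancel: "x + (x + y) = (y :: 'n::finite bits)"
  by (simp add: add.assoc[symmetric] bits_add_self)

lemma bits_add_eq_0_iff: "x + y = 0 \<longleftrightarrow> x = (y :: 'n::finite bits)"
  by (metis add.right_neutral bits_add_left_cancel bits_add_self)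

lemma bij_add_bits: "bij (\<lambda>x. x + (u :: 'n::finite bits))"
  by (rule bij_betw_byWitness[where f' = "\<lambda>x. x + u"]) (auto simp: add.assoc bits_add_self)

definition bit_sign :: "bit \<Rightarrow> complex"
  where "bit_sign b = (if b = 1 then - 1 else 1)"

text \<open>The group character (-1) to the power of the inner product of \<open>x\<close> and
  \<open>y\<close>: up to normalisation, an entry of the n-qubit Hadamard transform.\<close>

definition bits_char :: "'n::finite bits \<Rightarrow> 'n bits \<Rightarrow> complex"
  where "bits_char x y = (\<Prod>i\<in>UNIV. bit_sign (x $ i * y $ i))"

lemma bit_sign_simps [simp]: "bit_sign 0 = 1" "bit_sign 1 = - 1"
  by (simp_all add: bit_sign_def)

lemma bit_sign_add: "bit_sign (a + b) = bit_sign a * bit_sign b"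
  by (cases a; cases b) simp_all

lemma bits_char_0_left [simp]: "bits_char 0 y = 1"
  and bits_char_0_right [simp]: "bits_char x 0 = 1"
  by (simp_all add: bits_char_def)

lemma bits_char_commute: "bits_char x y = bits_char y x"
  by (simp only: bits_char_def mult.commute)

lemma bits_char_add_left: "bits_char (x + y) z = bits_char x z * bits_char y z"
  by (simp only: bits_char_def vector_add_component distrib_right bit_sign_add prod.distrib)

lemma bits_char_add_right: "bits_char x (y + z) = bits_char x y * bits_char x z"
  by (simp only: bits_char_def vector_add_component distrib_left bit_sign_add prod.distrib)

text \<open>Orthogonality of characters. If \<open>x\<close> has a 1 at position \<open>i\<close>,
  translating \<open>y\<close> by the unit vector at \<open>i\<close> permutes the terms and flips
  the sign of each, so the sum equals its own negative.\<close>

lemma sum_bits_char: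
  fixes x :: "'n::finite bits"
  shows "(\<Sum>y\<in>UNIV. bits_char x y) = (if x = 0 then 2 ^ CARD('n) else 0)"
proof (cases "x = 0")
  case True
  then show ?thesis
    by (simp add: UNIV_bit)
next
  case False
  then obtain i where i: "x $ i = 1"
    by (metis bit_not_zero_iff vec_eq_iff zero_index)
  let ?e = "axis i 1 :: 'n bits"
  have "bits_char x ?e = (\<Prod>j\<in>UNIV. if j = i then - 1 else 1)"
    unfolding bits_char_def by (rule prod.cong) (auto simp: axis_def i)
  also have "\<dots> = - 1"
    by simp
  finally have "bits_char x ?e = - 1" .
  moreover have "(\<Sum>y\<in>UNIV. bits_char x y) = (\<Sum>y\<in>UNIV. bits_char x (y + ?e))"
    using sum.reindex_bij_betw[OF bij_add_bits, of "bits_char x" ?e] by simp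
  ultimately have "(\<Sum>y\<in>UNIV. bits_char x y) = - (\<Sum>y\<in>UNIV. bits_char x y)"
    by (simp add: bits_char_add_right sum_negf)
  then show ?thesis
    using False by simp
qed

lemma tensor_power_hadamard:
  fixes x y :: "'n::finite bits"
  shows "tensor_power hadamard $ y $ x = bits_char y x / of_real (sqrt 2) ^ CARD('n)"
proof -
  have "hadamard $ a $ b = bit_sign (a * b) / of_real (sqrt 2)" for a b
    by (cases a; cases b) (simp_all add: hadamard_def)
  then show ?thesis
    by (simp add: tensor_power_def bits_char_def prod_dividef)
qed

text \<open>Amplitudes are pulled back along the inverse of \<open>\<phi>\<close>. The oracles and
  Toffoli gates permute the basis by involutions, so the inverse is \<open>\<phi>\<close>
  itself.\<close>

lemma basis_map_involution_mult:
  assumes "\<And>x. \<phi> (\<phi> x) = x"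
  shows "basis_map \<phi> *v v = (\<chi> y. v $ \<phi> y)"
proof -
  have "(\<Sum>k\<in>UNIV. (if y = \<phi> k then 1 else 0) * v $ k) = (\<Sum>k\<in>UNIV. if k = \<phi> y then v $ k else 0)"
    for y
    by (rule sum.cong) (auto simp: assms)
  then show ?thesis
    by (simp add: vec_eq_iff basis_map_def matrix_vector_mult_def)
qed

lemma tensor_mat_1_left_mult:
  "(mat 1 \<otimes>\<^sub>o B) *v v = (\<chi> z. (B *v (\<chi> k. v $ (fst z, k))) $ snd z)"
proof -
  have "(\<Sum>x\<in>UNIV. mat 1 $ r $ fst x * B $ s $ snd x * v $ x) = (\<Sum>k\<in>UNIV. B $ s $ k * v $ (r, k))"
    for r s
  proof -
    have "(\<Sum>x\<in>UNIV. mat 1 $ r $ fst x * B $ s $ snd x * v $ x) =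
        (\<Sum>j\<in>UNIV. if r = j then (\<Sum>k\<in>UNIV. B $ s $ k * v $ (j, k)) else 0)"
      unfolding UNIV_Times_UNIV[symmetric] sum.cartesian_product'
      by (rule sum.cong) (auto simp: mat_def)
    then show ?thesis
      by simp
  qed
  then show ?thesis
    by (simp add: vec_eq_iff tensor_def matrix_vector_mult_def)
qed

lemma tensor_mat_1_right_mult:
  "(A \<otimes>\<^sub>o mat 1) *v v = (\<chi> z. (A *v (\<chi> k. v $ (k, snd z))) $ fst z)"
proof -
  have "(\<Sum>x\<in>UNIV. A $ r $ fst x * mat 1 $ s $ snd x * v $ x) = (\<Sum>k\<in>UNIV. A $ r $ k * v $ (k, s))"
    for r s
  proof -
    have "(\<Sum>x\<in>UNIV. A $ r $ fst x * mat 1 $ s $ snd x * v $ x) =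
        (\<Sum>j\<in>UNIV. \<Sum>k\<in>UNIV. if s = k then A $ r $ j * v $ (j, k) else 0)"
      unfolding UNIV_Times_UNIV[symmetric] sum.cartesian_product'
      by (intro sum.cong) (auto simp: mat_def)
    then show ?thesis
      by simp
  qed
  then show ?thesis
    by (simp add: vec_eq_iff tensor_def matrix_vector_mult_def)
qed

text \<open>The amplitudes \<open>\<alpha>\<close> on the first 2n qubits, tensored with |-> on the
  last one. As \<open>\<alpha>\<close> is arbitrary, each later gate becomes a rule for transforming
  \<open>\<alpha>\<close> alone.\<close>

definition minus_state :: "('n::finite bits \<Rightarrow> 'n bits \<Rightarrow> complex) \<Rightarrow> complex ^ 'n regRQ"
  where "minus_state \<alpha> = (\<chi> z. case z of (r, q, a) \<Rightarrow> \<alpha> r q * bit_sign a / of_real (sqrt 2))"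

lemma minus_state_nth [simp]:
  "minus_state \<alpha> $ (r, q, a) = \<alpha> r q * bit_sign a / of_real (sqrt 2)"
  by (simp add: minus_state_def)

lemma minus_state_init:
  "on_Q_last (hadamard ** not_gate) *v (on_R C *v ket (0, 0, 0)) =
    minus_state (\<lambda>r q. if q = 0 then C $ r $ 0 else 0)"
proof -
  have R: "(on_R C *v ket (0, 0, 0)) $ (r, q, a) = (if q = 0 \<and> a = 0 then C $ r $ 0 else 0)" for r q a
    by (simp add: on_R_def tensor_def mat_def ket_def axis_def matrix_vector_mult_def zero_prod_def
        if_distrib[of "\<lambda>c. _ * c"] cong: if_cong)
  have H: "(hadamard ** not_gate) $ a $ 0 = bit_sign a / of_real (sqrt 2)" for a
    by (cases a) (simp_all add: matrix_matrix_mult_def UNIV_bit not_gate_def basis_map_def hadamard_def)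
  show ?thesis
    by (auto simp: vec_eq_iff on_Q_last_def on_Q_def tensor_mat_1_left_mult
        matrix_vector_mult_def[of "hadamard ** not_gate"] R H UNIV_bit)
qed

lemma on_Q_init_minus_state:
  "on_Q_init A *v minus_state \<alpha> = minus_state (\<lambda>r q. \<Sum>k\<in>UNIV. A $ q $ k * \<alpha> r k)"
  by (simp add: vec_eq_iff on_Q_init_def on_Q_def tensor_mat_1_left_mult tensor_mat_1_right_mult
      matrix_vector_mult_def[of A] sum_distrib_right sum_divide_distrib mult.assoc)

text \<open>Phase kickback: adding a bit \<open>b\<close> to the last qubit multiplies |-> by
  \<open>bit_sign b\<close>, and for the bit that the oracle adds at \<open>q\<close> this sign is
  \<open>h q\<close>.\<close>

lemma oracle_op_minus_state:
  assumes "range h \<subseteq> {1, - 1}"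
  shows "on_Q (oracle_op h) *v minus_state \<alpha> = minus_state (\<lambda>r q. of_int (h q) * \<alpha> r q)"
proof -
  have h: "h q = 1 \<or> h q = - 1" for q
    using assms by blast
  have "a + b + b = a" for a b :: bit
    by (cases a; cases b) simp_all
  then have inv: "(\<lambda>(x, a). (x, a + of_int ((1 - h x) div 2))) ((\<lambda>(x, a). (x, a + of_int ((1 - h x) div 2))) z) = z"
    for z :: "'a regQ"
    by (cases z) (simp only: prod.case)
  have sign: "bit_sign (of_int ((1 - h q) div 2)) = of_int (h q)" for q
    using h[of q] by auto
  show ?thesis
    unfolding on_Q_def oracle_op_def tensor_mat_1_left_mult basis_map_involution_mult[OF inv]
    by (simp only: vec_eq_iff split_paired_All vec_lambda_beta fst_conv snd_conv prod.case
        minus_state_nth bit_sign_add sign) (simp add: mult_ac)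
qed

lemma toffoli_minus_state:
  "toffoli i *v minus_state \<alpha> = minus_state (\<lambda>r q. bit_sign (r $ i * q $ i) * \<alpha> r q)"
proof -
  let ?\<phi> = "\<lambda>(r :: 'a bits, q :: 'a bits, a :: bit). (r, q, if r $ i = 1 \<and> q $ i = 1 then a + 1 else a)"
  have inv: "?\<phi> (?\<phi> z) = z" for z
    by (cases z) (simp add: add.assoc)
  have "bit_sign (if b = 1 \<and> c = 1 then a + 1 else a) = bit_sign (b * c) * bit_sign a" for a b c
    by (cases b; cases c) (simp_all add: bit_sign_add)
  then show ?thesis
    by (simp add: vec_eq_iff toffoli_def basis_map_involution_mult[of ?\<phi>, OF inv])
qed

lemma DC_minus_state: "DC *v minus_state \<alpha> = minus_state (\<lambda>r q. bits_char r q * \<alpha> r q)"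
proof -
  interpret comp_fun_commute "\<lambda>(i :: 'a) A. toffoli i ** A"
    by (rule comp_fun_commute_toffoli)
  \<comment> \<open>Generalised from \<open>UNIV\<close> to any \<open>I\<close> for finite
    induction: commutation lets the fold split off the inserted gate, which contributes one factor
    of the character.\<close>
  have "Finite_Set.fold (\<lambda>i A. toffoli i ** A) (mat 1) I *v minus_state \<alpha> =
      minus_state (\<lambda>r q. (\<Prod>i\<in>I. bit_sign (r $ i * q $ i)) * \<alpha> r q)" for I :: "'a set"
    using finite[of I]
    by induction
      (simp_all add: matrix_vector_mul_assoc[symmetric] toffoli_minus_state mult.assoc)
  then show ?thesis
    by (simp add: DC_def bits_char_def)
qed

text \<open>The unmeasured qubit is in state |->, so its two values each contribute half of the
  probability.\<close>

lemma outcome_prob_concat_bits: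
  "outcome_prob (minus_state \<alpha>) (concat_bits u v) = (cmod (\<alpha> u v))\<^sup>2"
proof -
  have inj: "concat_bits r q = concat_bits u v \<longleftrightarrow> r = u \<and> q = v" for r q
    by (auto simp: concat_bits_def vec_eq_iff split: sum.splits)
  have "{z. measured_qubits z = concat_bits u v} = {(u, v, 0), (u, v, 1)}"
    using UNIV_bit by (auto simp: measured_qubits_def inj)
  then show ?thesis
    by (simp add: outcome_prob_def norm_mult norm_divide power_divide)
qed

text \<open>Conjugating a phase \<open>bits_char r\<close> by the unnormalised Hadamard transform translates by \<open>r\<close>.\<close>

lemma sum_bits_char_translate:
  fixes F :: "'n::finite bits \<Rightarrow> complex"
  shows "(\<Sum>y\<in>UNIV. bits_char z y * (bits_char r y * (\<Sum>x\<in>UNIV. bits_char y x * F x))) =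
    2 ^ CARD('n) * F (z + r)"
proof -
  have "bits_char z y * (bits_char r y * (bits_char y x * F x)) = bits_char (z + r + x) y * F x" for x y
    by (simp add: bits_char_add_left bits_char_commute[of y x])
  then have "(\<Sum>y\<in>UNIV. bits_char z y * (bits_char r y * (\<Sum>x\<in>UNIV. bits_char y x * F x))) =
      (\<Sum>y\<in>UNIV. \<Sum>x\<in>UNIV. bits_char (z + r + x) y * F x)"
    by (simp only: sum_distrib_left)
  \<comment> \<open>With \<open>y\<close> summed first, orthogonality leaves only the term
    \<open>x = z + r\<close>.\<close>
  also have "\<dots> = (\<Sum>x\<in>UNIV. (\<Sum>y\<in>UNIV. bits_char (z + r + x) y) * F x)"
    by (subst sum.swap) (simp add: sum_distrib_right)
  also have "\<dots> = (\<Sum>x\<in>UNIV. if z + r = x then 2 ^ CARD('n) * F x else 0)"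
    by (rule sum.cong) (auto simp: sum_bits_char bits_add_eq_0_iff)
  finally show ?thesis
    by simp
qed

text \<open>The exponent counts Hadamard transforms: one on \<open>R\<close> and four on
  \<open>Q\<close> each give a factor \<open>1 / s\<close>, and the orthogonality sum in the
  translation gives back \<open>s * s\<close>.\<close>

lemma algorithm_hadamard_state:
  fixes f g :: "'n::finite bits \<Rightarrow> int"
  assumes "range f \<subseteq> {1, - 1}" and "range g \<subseteq> {1, - 1}"
  shows "algorithm f g (tensor_power hadamard) *v ket (0, 0, 0) =
    minus_state (\<lambda>r q. (\<Sum>z\<in>UNIV. bits_char q z * of_int (g z) * of_int (f (z + r))) /
      of_real (sqrt 2) ^ (3 * CARD('n)))"
proof -
  define s :: complex where "s = of_real (sqrt 2) ^ CARD('n)"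
  have s2: "s * s = 2 ^ CARD('n)"
    unfolding s_def power_mult_distrib[symmetric] of_real_mult[symmetric] by simp
  have s0: "s \<noteq> 0"
    by (simp add: s_def)
  have H: "tensor_power hadamard $ y $ x = bits_char y x / s" for x y :: "'n bits"
    by (simp add: tensor_power_hadamard s_def)
  \<comment> \<open>Both registers start at 0, where all characters are 1, so the first transforms
    produce the uniform superposition.\<close>
  have init: "(\<Sum>k\<in>UNIV. bits_char q k / s * (if k = 0 then bits_char r 0 / s else 0)) = 1 / (s * s)"
    for r q :: "'n bits"
    by (simp add: if_distrib[of "\<lambda>c. _ * c"] cong: if_cong)
  have translate: "(\<Sum>y\<in>UNIV. bits_char z y / s *
      (bits_char r y * (\<Sum>x\<in>UNIV. bits_char y x / s * (of_int (f x) * (1 / (s * s)))))) =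
      of_int (f (z + r)) / (s * s)" for z r
  proof -
    have "(\<Sum>y\<in>UNIV. bits_char z y / s *
        (bits_char r y * (\<Sum>x\<in>UNIV. bits_char y x / s * (of_int (f x) * (1 / (s * s)))))) =
        (\<Sum>y\<in>UNIV. bits_char z y * (bits_char r y * (\<Sum>x\<in>UNIV. bits_char y x * of_int (f x)))) /
        (s * s * (s * s))"
      by (simp add: sum_divide_distrib sum_distrib_left mult_ac)
    also have "\<dots> = of_int (f (z + r)) / (s * s)"
      using s0 by (simp add: sum_bits_char_translate s2[symmetric])
    finally show ?thesis .
  qed
  have final: "(\<Sum>z\<in>UNIV. bits_char q z / s * (of_int (g z) * (of_int (f (z + r)) / (s * s)))) =
      (\<Sum>z\<in>UNIV. bits_char q z * of_int (g z) * of_int (f (z + r))) /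
      of_real (sqrt 2) ^ (3 * CARD('n))" for q r
  proof -
    have "3 * CARD('n) = CARD('n) + (CARD('n) + CARD('n))"
      by simp
    then have "of_real (sqrt 2) ^ (3 * CARD('n)) = s * (s * s)"
      by (simp only: s_def power_add)
    then show ?thesis
      by (simp add: sum_divide_distrib mult_ac)
  qed
  show ?thesis
    unfolding algorithm_def matrix_vector_mul_assoc[symmetric] minus_state_init
      on_Q_init_minus_state oracle_op_minus_state[OF assms(1)] oracle_op_minus_state[OF assms(2)]
      DC_minus_state H init translate final ..
qed

theorem theorem8:
  fixes f g :: "'n::finite bits \<Rightarrow> int"
  assumes "range f \<subseteq> {1, - 1}" and "range g \<subseteq> {1, - 1}"
  shows "\<forall>u. outcome_prob (algorithm f g (tensor_power hadamard) *v ket (0, 0, 0)) (concat_bits u 0) =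
    (real_of_int (cross_correlation f g u))\<^sup>2 / 2 ^ (3 * CARD('n))"
proof
  fix u
  \<comment> \<open>Substituting \<open>x = z + u\<close> moves the translation from
    \<open>g\<close> to \<open>f\<close>, as in the final amplitude, because
    \<open>u + u = 0\<close>.\<close>
  have "cross_correlation f g u = (\<Sum>z\<in>UNIV. f (z + u) * g (z + u + u))"
    unfolding cross_correlation_def
    using sum.reindex_bij_betw[OF bij_add_bits, of "\<lambda>x. f x * g (x + u)" u] by simp
  then have "(\<Sum>z\<in>UNIV. of_int (g z) * of_int (f (z + u))) = complex_of_int (cross_correlation f g u)"
    by (simp add: add.assoc bits_add_self mult.commute)
  moreover have "(sqrt 2 ^ (3 * CARD('n)))\<^sup>2 = 2 ^ (3 * CARD('n))"
    by (metis power_mult mult.commute real_sqrt_pow2 zero_le_numeral)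
  \<comment> \<open>At \<open>q = 0\<close> every \<open>bits_char q z\<close> is 1, so the
    amplitude is the plain correlation sum.\<close>
  ultimately show "outcome_prob (algorithm f g (tensor_power hadamard) *v ket (0, 0, 0)) (concat_bits u 0) =
      (real_of_int (cross_correlation f g u))\<^sup>2 / 2 ^ (3 * CARD('n))"
    by (simp add: algorithm_hadamard_state[OF assms] outcome_prob_concat_bits norm_divide norm_power
        power_divide)
qed

end
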